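(* Let $k\ge1$, let $l\ge0$ be an integer, $1\le p\le\infty$ and $\hat T=[-1,1]^d$. For every $\hat v\in\mathbb{Q}_k(\hat T)$, $$\|\hat v\|_{l,p,\hat T}\le\binom{d+l}{l}^{1/p}\big(C_{M,p}\,k^2\big)^l\,\|\hat v\|_{0,p,\hat T},$$ where $$C_{M,p}:=2(p-1)^{1/p-1}\Big(p+\frac1k\Big)\Big(1+\frac{p}{kp-p+1}\Big)^{k-1+1/p}\quad(1\le p<\infty),\qquad C_{M,\infty}:=1 .$$
   Context: $\mathbb{Q}_k(\hat T)$ is the span of the monomials $\hat x^\alpha$, $\alpha\in\mathbb{N}_0^d$, $\|\alpha\|_{\ell^\infty}\le k$. $\|\hat v\|_{l,p,\hat T}=\big(\sum_{|\alpha|\le l}\|\partial^\alpha\hat v\|_{L^p(\hat T)}^p\big)^{1/p}$ for $p<\infty$ and $\|\hat v\|_{l,\infty,\hat T}=\max_{|\alpha|\le l}\|\partial^\alpha\hat v\|_{L^\infty(\hat T)}$. Conventions: $1/\infty=0$; for $p=1$ the factor $(p-1)^{1/p-1}$ is $0^0:=1$ (its limit as $p\to1^+$). *)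

theory Defs
  imports "HOL-Probability.Essential_Supremum"
begin

text \<open>
  The dimension is \<open>d = CARD('n)\<close>; a multi-index is a function \<open>\<alpha> :: 'n \<Rightarrow> nat\<close>.
\<close>

definition monomial_fun :: "('n::finite \<Rightarrow> nat) \<Rightarrow> real ^ 'n \<Rightarrow> real"
  where "monomial_fun \<alpha> x = (\<Prod>i\<in>UNIV. (x $ i) ^ \<alpha> i)"

text \<open>
  The elements are taken as polynomial functions on the whole space, so that partial derivatives
  also make sense on the boundary of the cube. The cube has nonempty interior, so such a function
  is determined by its restriction to the cube.
\<close>

definition Q_space :: "nat \<Rightarrow> (real ^ 'n::finite \<Rightarrow> real) set"
  where "Q_space k = {v. \<exists>c. v = (\<lambda>x. \<Sum>\<alpha>\<in>{\<alpha>. \<forall>i. \<alpha> i \<le> k}. c \<alpha> * monomial_fun \<alpha> x)}"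

definition ref_cube :: "(real ^ 'n::finite) set"
  where "ref_cube = cbox (\<chi> i. - 1) (\<chi> i. 1)"

definition partial_deriv :: "'n::finite \<Rightarrow> (real ^ 'n \<Rightarrow> real) \<Rightarrow> real ^ 'n \<Rightarrow> real"
  where "partial_deriv i f x = deriv (\<lambda>t. f (x + t *\<^sub>R axis i 1)) 0"

text \<open>
  The derivative \<open>\<partial>\<^sup>\<alpha>\<close> differentiates \<open>\<alpha> i\<close> times in direction \<open>i\<close>. The type \<open>'n\<close> carries no
  order, so some list of directions with these multiplicities is chosen; for smooth functions the
  choice is immaterial, since partial derivatives commute.
\<close>

definition multi_deriv :: "('n::finite \<Rightarrow> nat) \<Rightarrow> (real ^ 'n \<Rightarrow> real) \<Rightarrow> real ^ 'n \<Rightarrow> real"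
  where "multi_deriv \<alpha> f = foldr partial_deriv (SOME is. \<forall>i. count_list is i = \<alpha> i) f"

lemma ex_direction_list: "\<exists>is. \<forall>i. count_list is i = (\<alpha> :: 'n::finite \<Rightarrow> nat) i"
proof -
  obtain xs :: "'n list" where xs: "set xs = UNIV" "distinct xs"
    using finite_distinct_list[of "UNIV :: 'n set"] by auto
  have replicate: "count_list (replicate m j) i = (if i = j then m else 0)" for m and i j :: 'n
    by (induction m) auto
  have "count_list (concat (map (\<lambda>j. replicate (\<alpha> j) j) ys)) i = (if i \<in> set ys then \<alpha> i else 0)"
    if "distinct ys" for ys i
    using that by (induction ys) (auto simp: replicate)
  with xs have "\<forall>i. count_list (concat (map (\<lambda>j. replicate (\<alpha> j) j) xs)) i = \<alpha> i"
    by simp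
  then show ?thesis ..
qed

text \<open>
  The exponent \<open>p\<close> ranges over the extended reals; \<open>real_of_ereal (1 / p)\<close> is \<open>0\<close> for \<open>p = \<infinity>\<close>.
\<close>

definition Lp_norm :: "ereal \<Rightarrow> (real ^ 'n::finite) set \<Rightarrow> (real ^ 'n \<Rightarrow> real) \<Rightarrow> real"
  where "Lp_norm p S f =
    (if p = \<infinity> then real_of_ereal (esssup (lebesgue_on S) (\<lambda>x. ereal \<bar>f x\<bar>))
     else (LINT x|lebesgue_on S. \<bar>f x\<bar> powr real_of_ereal p) powr real_of_ereal (1 / p))"

definition sobolev_norm :: "nat \<Rightarrow> ereal \<Rightarrow> (real ^ 'n::finite) set \<Rightarrow> (real ^ 'n \<Rightarrow> real) \<Rightarrow> real"
  where "sobolev_norm l p S f =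
    (if p = \<infinity> then Max ((\<lambda>\<alpha>. Lp_norm p S (multi_deriv \<alpha> f)) ` {\<alpha>. sum \<alpha> UNIV \<le> l})
     else (\<Sum>\<alpha>\<in>{\<alpha>. sum \<alpha> UNIV \<le> l}. Lp_norm p S (multi_deriv \<alpha> f) powr real_of_ereal p)
            powr real_of_ereal (1 / p))"

lemma finite_multi_index: "finite {\<alpha> :: 'n::finite \<Rightarrow> nat. \<forall>i. \<alpha> i \<le> k}"
proof -
  have "{\<alpha> :: 'n \<Rightarrow> nat. \<forall>i. \<alpha> i \<le> k} = UNIV \<rightarrow>\<^sub>E {..k}"
    by (auto simp: PiE_def Pi_def extensional_def)
  then show ?thesis
    by (simp add: finite_PiE)
qed

lemma finite_multi_index_sum: "finite {\<alpha> :: 'n::finite \<Rightarrow> nat. sum \<alpha> UNIV \<le> l}"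
proof (rule finite_subset[OF _ finite_multi_index])
  have "\<alpha> i \<le> sum \<alpha> UNIV" for \<alpha> :: "'n \<Rightarrow> nat" and i
    by (rule member_le_sum) auto
  then show "{\<alpha> :: 'n \<Rightarrow> nat. sum \<alpha> UNIV \<le> l} \<subseteq> {\<alpha>. \<forall>i. \<alpha> i \<le> l}"
    using order_trans by blast
qed

text \<open>
  The case \<open>p = 1\<close> of the factor \<open>(p - 1)\<^bsup>1/p - 1\<^esup>\<close> is separate because \<open>0 powr 0 = 0\<close>, whereas the
  convention here is \<open>0\<^sup>0 = 1\<close>.
\<close>

definition markov_factor :: "real \<Rightarrow> real"
  where "markov_factor p = (if p = 1 then 1 else (p - 1) powr (1 / p - 1))"

definition markov_const :: "ereal \<Rightarrow> nat \<Rightarrow> real"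
  where "markov_const p k =
    (if p = \<infinity> then 1
     else let q = real_of_ereal p in
       2 * markov_factor q * (q + 1 / real k)
         * (1 + q / (real k * q - q + 1)) powr (real k - 1 + 1 / q))"

end

theory Submission
  imports Defs "HOL-Computational_Algebra.Polynomial"
begin

text \<open>
  Lagrange interpolation at the Chebyshev nodes \<open>x\<^sub>j = cos \<theta>\<^sub>j\<close> yields a formula of M. Riesz type:
  \<open>sin \<theta> Q'(cos \<theta>)\<close> is a combination of values \<open>Q(cos (\<theta> \<plusminus> \<theta>\<^sub>j))\<close> whose coefficients have absolute
  sum \<open>n\<close>. Applied at \<open>\<theta> = \<theta>\<^sub>i\<close> and interpolated once more at 1, it expresses \<open>Q'(1)\<close> by values
  of \<open>Q\<close> on \<open>[-1, 1]\<close> with absolute coefficient sum \<open>n\<^sup>2\<close>.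

  For \<open>p < \<infinity>\<close> this formula, rescaled to length 1, writes \<open>\<partial>\<^sub>i v\<close> on the half cube \<open>x\<^sub>i \<le> 0\<close> as a
  combination of translates of \<open>v\<close> that stay inside the cube, with absolute coefficient sum \<open>2 k\<^sup>2\<close>;
  likewise on the other half. By Jensen's inequality and translation invariance
  \<open>\<parallel>\<partial>\<^sub>i v\<parallel>\<^sub>p \<le> 2\<^bsup>1/p\<^esup> 2 k\<^sup>2 \<parallel>v\<parallel>\<^sub>p\<close>, and Bernoulli's inequality bounds the factor
  \<open>2\<^bsup>1/p\<^esup> 2\<close> by the constant of the theorem. For \<open>p = \<infinity>\<close> the constant must be 1: this is A. A. Markov's inequality on slices, from Bernstein's inequality in the
  middle of \<open>[-1, 1]\<close> and Schur's argument beyond the extreme Chebyshev nodes.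
\<close>

section \<open>Lagrange interpolation and polynomials in the cosine\<close>

text \<open>Both sides are polynomials in \<open>t\<close> of degree below \<open>n\<close> that
  agree at the \<open>n\<close> distinct nodes, so they coincide.\<close>

lemma lagrange_interpolation_formula:
  fixes x :: "nat \<Rightarrow> real" and U :: "real poly"
  assumes inj: "inj_on x {..<n}" and deg: "degree U < n"
  shows "poly U t = (\<Sum>j<n. poly U (x j) * (\<Prod>i\<in>{..<n} - {j}. (t - x i) / (x j - x i)))"
proof -
  define L where "L j = (\<Prod>i\<in>{..<n} - {j}. smult (1 / (x j - x i)) [:- x i, 1:])" for j
  define R where "R = (\<Sum>j<n. smult (poly U (x j)) (L j))"
  have poly_L: "poly (L j) s = (\<Prod>i\<in>{..<n} - {j}. (s - x i) / (x j - x i))" for j s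
    unfolding L_def poly_prod by (intro prod.cong) (auto simp: diff_divide_distrib)
  have kron: "poly (L j) (x m) = (if j = m then 1 else 0)" if "j < n" "m < n" for j m
  proof (cases "j = m")
    case True
    have "(x m - x i) / (x m - x i) = 1" if "i \<in> {..<n} - {m}" for i
      using that inj \<open>m < n\<close> by (auto simp: inj_on_def)
    then show ?thesis unfolding poly_L using True by simp
  next
    case False
    then show ?thesis unfolding poly_L using that by (auto intro!: prod_zero bexI[of _ m])
  qed
  have degL: "degree (L j) < n" if "j < n" for j
  proof -
    have "degree (L j) \<le> (\<Sum>i\<in>{..<n} - {j}. degree (smult (1 / (x j - x i)) [:- x i, 1:]))"
      unfolding L_def by (rule order_trans[OF degree_prod_sum_le]) auto
    also have "\<dots> \<le> (\<Sum>i\<in>{..<n} - {j}. 1)"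
      by (intro sum_mono) (auto intro: order_trans[OF degree_smult_le])
    also have "\<dots> = n - 1" using that by simp
    finally show ?thesis using that by simp
  qed
  have degR: "degree R < n"
    unfolding R_def
    by (rule degree_sum_less) (use deg degL in \<open>auto intro: le_less_trans[OF degree_smult_le]\<close>)
  have "U = R"
  proof (rule poly_eqI_degree[where A = "x ` {..<n}"])
    fix s assume "s \<in> x ` {..<n}"
    then obtain m where m: "m < n" "s = x m" by auto
    have "poly R s = (\<Sum>j<n. poly U (x j) * (if j = m then 1 else 0))"
      unfolding R_def poly_sum using m kron by (intro sum.cong) auto
    also have "\<dots> = poly U s" using m by (simp add: if_distrib[of "(*) _"] cong: if_cong)
    finally show "poly U s = poly R s" by simp
  qed (use deg degR inj in \<open>auto simp: card_image\<close>)
  then have "poly U t = poly R t" by simp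
  then show ?thesis by (simp add: R_def poly_sum poly_L)
qed

text \<open>\<open>T\<close> and \<open>U\<close> are the Chebyshev polynomials of the first kind of
  degree \<open>n + 1\<close> and of the second kind of degree \<open>n\<close>. The addition
  formulas carry both through one induction. The value of \<open>U\<close> at 1 later becomes the
  absolute sum of the Riesz weights.\<close>

lemma cos_sin_multiple_poly:
  "\<exists>T U :: real poly. degree T \<le> Suc n \<and> degree U \<le> n \<and> poly T 1 = 1 \<and> poly U 1 = real (Suc n) \<and>
     (\<forall>\<phi>. cos (real (Suc n) * \<phi>) = poly T (cos \<phi>) \<and> sin (real (Suc n) * \<phi>) = sin \<phi> * poly U (cos \<phi>))"
proof (induction n)
  case 0
  show ?case by (rule exI[of _ "[:0, 1:]"], rule exI[of _ 1]) auto
next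
  case (Suc n)
  then obtain T U :: "real poly" where TU: "degree T \<le> Suc n" "degree U \<le> n" "poly T 1 = 1"
     "poly U 1 = real (Suc n)" "\<And>\<phi>. cos (real (Suc n) * \<phi>) = poly T (cos \<phi>)"
     "\<And>\<phi>. sin (real (Suc n) * \<phi>) = sin \<phi> * poly U (cos \<phi>)" by blast
  have add: "real (Suc (Suc n)) * \<phi> = real (Suc n) * \<phi> + \<phi>" for \<phi>
    by (simp add: algebra_simps)
  have dX: "degree ([:0, 1:] * T) \<le> Suc (Suc n)" "degree ([:0, 1:] * U) \<le> Suc n"
    using TU degree_mult_le[of "[:0,1:]" T] degree_mult_le[of "[:0,1:]" U] by (auto simp del: mult_pCons_left)
  have d2: "degree ([:1, 0, -1:] * U) \<le> Suc (Suc n)"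
    using TU degree_mult_le[of "[:1,0,-1:]" U] by (auto simp del: mult_pCons_left)
  show ?case
  proof (rule exI[of _ "[:0, 1:] * T - [:1, 0, -1:] * U"], rule exI[of _ "[:0, 1:] * U + T"], intro conjI allI)
    show "degree ([:0, 1:] * T - [:1, 0, -1:] * U) \<le> Suc (Suc n)"
      using dX d2 by (intro degree_diff_le)
    show "degree ([:0, 1:] * U + T) \<le> Suc n"
      using dX TU by (intro degree_add_le)
    fix \<phi> :: real
    have s: "sin \<phi> * sin \<phi> = 1 - cos \<phi> * cos \<phi>"
      using sin_cos_squared_add[of \<phi>] by (simp add: power2_eq_square)
    have "sin \<phi> * poly U (cos \<phi>) * sin \<phi> = (1 - cos \<phi> * cos \<phi>) * poly U (cos \<phi>)"
      unfolding s[symmetric] by simp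
    then show "cos (real (Suc (Suc n)) * \<phi>) = poly ([:0, 1:] * T - [:1, 0, -1:] * U) (cos \<phi>)"
      unfolding add cos_add TU by (simp add: algebra_simps)
    show "sin (real (Suc (Suc n)) * \<phi>) = sin \<phi> * poly ([:0, 1:] * U + T) (cos \<phi>)"
      unfolding add sin_add TU by (simp add: algebra_simps)
  qed (use TU in auto)
qed

text \<open>Separates the even part in \<phi> from the odd part, which is \<open>sin \<phi>\<close>
  times a polynomial of degree one less. The clause for \<open>n = 0\<close> makes up for the
  truncated \<open>n - 1\<close>: there the degree bound 0 would be too weak for the induction
  step.\<close>

lemma poly_cos_add_split:
  fixes Q :: "real poly" and \<theta> :: real
  assumes "degree Q \<le> n"
  shows "\<exists>E O'. degree E \<le> n \<and> degree O' \<le> n - 1 \<and> (n = 0 \<longrightarrow> O' = 0) \<and>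
    (\<forall>\<phi>. poly Q (cos (\<theta> + \<phi>)) = poly E (cos \<phi>) - sin \<phi> * poly O' (cos \<phi>) \<and>
         poly Q (cos (\<theta> - \<phi>)) = poly E (cos \<phi>) + sin \<phi> * poly O' (cos \<phi>))"
  using assms
proof (induction n arbitrary: Q)
  case 0
  then obtain a where a: "Q = [:a:]" using degree_eq_zeroE by blast
  show ?case unfolding a by (rule exI[of _ "[:a:]"], rule exI[of _ 0]) auto
next
  case (Suc n)
  obtain a Q' where Q: "Q = pCons a Q'" by (cases Q)
  have "degree Q' \<le> n" using Suc.prems Q by (auto split: if_splits)
  from Suc.IH[OF this] obtain E O' where EO: "degree E \<le> n" "degree O' \<le> n - 1" "n = 0 \<Longrightarrow> O' = 0"
    "\<And>\<phi>. poly Q' (cos (\<theta> + \<phi>)) = poly E (cos \<phi>) - sin \<phi> * poly O' (cos \<phi>)"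
    "\<And>\<phi>. poly Q' (cos (\<theta> - \<phi>)) = poly E (cos \<phi>) + sin \<phi> * poly O' (cos \<phi>)" by blast
  define A where "A = cos \<theta>"
  define B where "B = sin \<theta>"
  \<comment> \<open>Multiplying \<open>A * cos \<phi> - B * sin \<phi>\<close> by the split form of
    \<open>Q'\<close> gives these two parts; the product of the two sines becomes
    \<open>1 - cos \<phi> * cos \<phi>\<close>, hence the coefficients
    \<open>[:B, 0, -B:]\<close>.\<close>
  let ?E = "[:a:] + [:0, A:] * E + [:B, 0, -B:] * O'"
  let ?O = "[:0, A:] * O' + smult B E"
  have d: "degree ([:0, A:] * E) \<le> Suc n" "degree ([:B, 0, -B:] * O') \<le> Suc n" "degree ([:0, A:] * O') \<le> n"
  proof -
    have l: "degree [:0, A:] \<le> 1" "degree [:B, 0, -B:] \<le> 2" by auto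
    show "degree ([:0, A:] * E) \<le> Suc n"
      using degree_mult_le[of "[:0, A:]" E] l EO(1) by linarith
    show "degree ([:B, 0, -B:] * O') \<le> Suc n" "degree ([:0, A:] * O') \<le> n"
      using degree_mult_le[of "[:B, 0, -B:]" O'] degree_mult_le[of "[:0, A:]" O'] l EO(2,3)
      by (cases "n = 0"; simp del: mult_pCons_left)+
  qed
  have s: "sin \<phi> * sin \<phi> = 1 - cos \<phi> * cos \<phi>" for \<phi> :: real
    using sin_cos_squared_add[of \<phi>] by (simp add: power2_eq_square)
  show ?case
  proof (rule exI[of _ ?E], rule exI[of _ ?O], intro conjI allI)
    show "degree ?E \<le> Suc n" using d by (intro degree_add_le) auto
    show "degree ?O \<le> Suc n - 1"
      using d EO(1) by (intro degree_add_le) (auto intro: order_trans[OF degree_smult_le])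
    fix \<phi> :: real
    have c: "B * (sin \<phi> * (sin \<phi> * poly O' (cos \<phi>))) = B * ((1 - cos \<phi> * cos \<phi>) * poly O' (cos \<phi>))"
      unfolding s[symmetric] by simp
    have "poly Q (cos (\<theta> + \<phi>)) = a + (A * cos \<phi> - B * sin \<phi>) * (poly E (cos \<phi>) - sin \<phi> * poly O' (cos \<phi>))"
      unfolding Q EO(4)[symmetric] by (simp add: cos_add A_def B_def)
    then show "poly Q (cos (\<theta> + \<phi>)) = poly ?E (cos \<phi>) - sin \<phi> * poly ?O (cos \<phi>)"
      using c by (simp add: algebra_simps)
    have "poly Q (cos (\<theta> - \<phi>)) = a + (A * cos \<phi> + B * sin \<phi>) * (poly E (cos \<phi>) + sin \<phi> * poly O' (cos \<phi>))"
      unfolding Q EO(5)[symmetric] by (simp add: cos_diff A_def B_def)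
    then show "poly Q (cos (\<theta> - \<phi>)) = poly ?E (cos \<phi>) + sin \<phi> * poly ?O (cos \<phi>)"
      using c by (simp add: algebra_simps)
  qed auto
qed

section \<open>Chebyshev nodes and Riesz weights\<close>

text \<open>These are the zeros of \<open>cos (real n * \<theta>)\<close> between 0 and
  \<open>pi\<close>; their cosines are the zeros of the Chebyshev polynomial of degree
  \<open>n\<close>, numbered from right to left.\<close>

definition cheb_angle :: "nat \<Rightarrow> nat \<Rightarrow> real"
  where "cheb_angle n j = (2 * real j + 1) * pi / (2 * real n)"

definition cheb_lagrange :: "nat \<Rightarrow> nat \<Rightarrow> real \<Rightarrow> real"
  where "cheb_lagrange n j t = (\<Prod>i\<in>{..<n} - {j}.
    (t - cos (cheb_angle n i)) / (cos (cheb_angle n j) - cos (cheb_angle n i)))"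

text \<open>Coefficients of interpolation at 1 when the data are the products
  \<open>sin \<theta> * poly U (cos \<theta>)\<close> at the node angles; odd parts and Bernstein's
  inequality supply such products.\<close>

definition riesz_weight :: "nat \<Rightarrow> nat \<Rightarrow> real"
  where "riesz_weight n j = cheb_lagrange n j 1 / sin (cheb_angle n j)"

lemma cheb_angle_bounds:
  assumes "j < n"
  shows "0 < cheb_angle n j" "cheb_angle n j < pi"
proof -
  show "0 < cheb_angle n j" using assms by (simp add: cheb_angle_def)
  have "2 * real j + 1 < 2 * real n" using assms by linarith
  then show "cheb_angle n j < pi" using assms by (simp add: cheb_angle_def divide_less_eq mult.commute)
qed

lemma sin_cheb_angle_pos: "j < n \<Longrightarrow> 0 < sin (cheb_angle n j)"
  using cheb_angle_bounds by (simp add: sin_gt_zero)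

lemma cheb_angle_less: "i < j \<Longrightarrow> j < n \<Longrightarrow> cheb_angle n i < cheb_angle n j"
  by (auto simp: cheb_angle_def intro!: divide_strict_right_mono)

lemma cos_cheb_angle_less:
  assumes "i < j" "j < n" 
  shows "cos (cheb_angle n j) < cos (cheb_angle n i)"
  using assms cheb_angle_less[OF assms] cheb_angle_bounds[of i n] cheb_angle_bounds[of j n]
  by (intro cos_monotone_0_pi) auto

lemma inj_on_cos_cheb_angle: "inj_on (\<lambda>j. cos (cheb_angle n j)) {..<n}"
  by (rule linorder_inj_onI') (use cos_cheb_angle_less in force)

lemma cheb_interpolation:
  "degree U < n \<Longrightarrow> poly U t = (\<Sum>j<n. poly U (cos (cheb_angle n j)) * cheb_lagrange n j t)"
  unfolding cheb_lagrange_def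
  by (rule lagrange_interpolation_formula[OF inj_on_cos_cheb_angle])

text \<open>The nodes decrease in their index, so exactly \<open>j\<close> denominators are negative
  and \<open>(-1) ^ j\<close> compensates their signs. From the largest node on, every numerator is
  nonnegative and grows with \<open>t\<close>.\<close>

lemma cheb_lagrange_sign_mono:
  assumes j: "j < n" and t: "cos (cheb_angle n 0) \<le> t" "t \<le> s"
  shows "0 \<le> (-1) ^ j * cheb_lagrange n j t"
    and "(-1) ^ j * cheb_lagrange n j t \<le> (-1) ^ j * cheb_lagrange n j s"
proof -
  let ?x = "\<lambda>i. cos (cheb_angle n i)"
  let ?f = "\<lambda>t i. (t - ?x i) / \<bar>?x j - ?x i\<bar>"
  have eq: "(-1) ^ j * cheb_lagrange n j u = (\<Prod>i\<in>{..<n} - {j}. ?f u i)" for u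
  proof -
    have "(\<Prod>i\<in>{..<n} - {j}. if i < j then -1 else (1::real)) = (\<Prod>i\<in>{..<j}. -1)"
      using j by (intro prod.mono_neutral_cong_right) auto
    then have "(-1) ^ j * cheb_lagrange n j u
      = (\<Prod>i\<in>{..<n} - {j}. (if i < j then -1 else 1) * ((u - ?x i) / (?x j - ?x i)))"
      unfolding cheb_lagrange_def prod.distrib by simp
    also have "\<dots> = (\<Prod>i\<in>{..<n} - {j}. ?f u i)"
    proof (intro prod.cong refl)
      fix i assume i: "i \<in> {..<n} - {j}"
      show "(if i < j then -1 else 1) * ((u - ?x i) / (?x j - ?x i)) = ?f u i"
        using i cos_cheb_angle_less[of i j n] cos_cheb_angle_less[of j i n] j
        by (cases "i < j") (auto simp: abs_if divide_simps algebra_simps)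
    qed
    finally show ?thesis .
  qed
  have nn: "0 \<le> ?f t i" if "i < n" for i
    using cos_cheb_angle_less[of 0 i n] that t by (cases "i = 0") auto
  show "0 \<le> (-1) ^ j * cheb_lagrange n j t" unfolding eq using nn by (intro prod_nonneg) auto
  show "(-1) ^ j * cheb_lagrange n j t \<le> (-1) ^ j * cheb_lagrange n j s"
    unfolding eq using nn t by (intro prod_mono) (auto intro!: divide_right_mono)
qed

lemma abs_cheb_lagrange:
  assumes "j < n" "cos (cheb_angle n 0) \<le> t"
  shows "\<bar>cheb_lagrange n j t\<bar> = (-1) ^ j * cheb_lagrange n j t"
proof -
  have "\<bar>cheb_lagrange n j t\<bar> = \<bar>(-1) ^ j * cheb_lagrange n j t\<bar>" by (simp add: abs_mult power_abs)
  then show ?thesis using cheb_lagrange_sign_mono(1)[OF assms order_refl] by simp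
qed

text \<open>The Chebyshev polynomial of the second kind of degree \<open>n - 1\<close> has the value
  \<open>n\<close> at 1 and the value \<open>(-1) ^ j / sin (cheb_angle n j)\<close> at the nodes.
  These signs match those of the Lagrange basis at 1, so interpolating it at 1 sums absolute
  values.\<close>

lemma sum_abs_riesz_weight:
  assumes "0 < n"
  shows "(\<Sum>j<n. \<bar>riesz_weight n j\<bar>) = real n"
proof -
  obtain m where n: "n = Suc m" using assms gr0_implies_Suc by blast
  obtain U :: "real poly" where U: "degree U \<le> m" "poly U 1 = real n"
     "\<And>\<phi>. sin (real n * \<phi>) = sin \<phi> * poly U (cos \<phi>)"
    using cos_sin_multiple_poly[of m] unfolding n by blast
  have "real n = (\<Sum>j<n. poly U (cos (cheb_angle n j)) * cheb_lagrange n j 1)"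
    using cheb_interpolation[of U n 1] U n by simp
  also have "\<dots> = (\<Sum>j<n. \<bar>riesz_weight n j\<bar>)"
  proof (intro sum.cong refl)
    fix j assume "j \<in> {..<n}"
    then have j: "j < n" by simp
    have "real n * cheb_angle n j = real j * pi + pi / 2"
      using assms by (simp add: cheb_angle_def field_simps)
    then have "sin (cheb_angle n j) * poly U (cos (cheb_angle n j)) = (-1) ^ j"
      using U(3)[of "cheb_angle n j"] by (simp add: sin_add)
    then have "poly U (cos (cheb_angle n j)) = (-1) ^ j / sin (cheb_angle n j)"
      using sin_cheb_angle_pos[OF j] by (simp add: field_simps)
    then show "poly U (cos (cheb_angle n j)) * cheb_lagrange n j 1 = \<bar>riesz_weight n j\<bar>"
      using abs_cheb_lagrange[OF j cos_le_one] sin_cheb_angle_pos[OF j]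
      by (simp add: riesz_weight_def)
  qed
  finally show ?thesis by simp
qed

lemma riesz_interpolation_at_1:
  assumes "degree U < n"
  shows "poly U 1 = (\<Sum>j<n. riesz_weight n j * (sin (cheb_angle n j) * poly U (cos (cheb_angle n j))))"
  unfolding cheb_interpolation[OF assms, of 1]
proof (intro sum.cong refl)
  fix j assume "j \<in> {..<n}"
  then have "sin (cheb_angle n j) \<noteq> 0" using sin_cheb_angle_pos[of j n] by simp
  then show "poly U (cos (cheb_angle n j)) * cheb_lagrange n j 1
    = riesz_weight n j * (sin (cheb_angle n j) * poly U (cos (cheb_angle n j)))"
    by (simp add: riesz_weight_def)
qed

text \<open>Schur's argument: from the largest node up to 1, each Lagrange basis polynomial is in
  absolute value at most what it is at 1, so the absolute weight sum \<open>n\<close>, which belongs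
  to the point 1, also serves for \<open>t\<close>.\<close>

lemma schur_near_endpoint:
  assumes U: "degree U < n" and M: "\<And>j. j < n \<Longrightarrow> \<bar>sin (cheb_angle n j) * poly U (cos (cheb_angle n j))\<bar> \<le> M"
    and t: "cos (cheb_angle n 0) \<le> t" "t \<le> 1"
  shows "\<bar>poly U t\<bar> \<le> real n * M"
proof -
  have "\<bar>poly U t\<bar> \<le> (\<Sum>j<n. \<bar>poly U (cos (cheb_angle n j)) * cheb_lagrange n j t\<bar>)"
    unfolding cheb_interpolation[OF U, of t] by (rule sum_abs)
  also have "\<dots> \<le> (\<Sum>j<n. M * \<bar>riesz_weight n j\<bar>)"
  proof (rule sum_mono)
    fix j assume "j \<in> {..<n}"
    then have j: "j < n" by simp
    have le: "\<bar>cheb_lagrange n j t\<bar> \<le> \<bar>cheb_lagrange n j 1\<bar>"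
      using cheb_lagrange_sign_mono(2)[OF j t] abs_cheb_lagrange[OF j t(1)]
        abs_cheb_lagrange[OF j cos_le_one] by simp
    have s: "0 < sin (cheb_angle n j)" by (rule sin_cheb_angle_pos[OF j])
    have "\<bar>poly U (cos (cheb_angle n j)) * cheb_lagrange n j t\<bar>
      \<le> \<bar>poly U (cos (cheb_angle n j))\<bar> * \<bar>cheb_lagrange n j 1\<bar>"
      unfolding abs_mult using le by (intro mult_left_mono) auto
    also have "\<dots> = \<bar>sin (cheb_angle n j) * poly U (cos (cheb_angle n j))\<bar> * \<bar>riesz_weight n j\<bar>"
      using s by (simp add: riesz_weight_def abs_mult)
    also have "\<dots> \<le> M * \<bar>riesz_weight n j\<bar>" using M[OF j] by (intro mult_right_mono) auto
    finally show "\<bar>poly U (cos (cheb_angle n j)) * cheb_lagrange n j t\<bar> \<le> M * \<bar>riesz_weight n j\<bar>" .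
  qed
  also have "\<dots> = real n * M"
    using sum_abs_riesz_weight[of n] U by (simp flip: sum_distrib_left)
  finally show ?thesis .
qed

section \<open>M. Riesz's formula and the inequalities of Bernstein and Markov\<close>

text \<open>The odd part in \<phi> of \<open>poly Q (cos (\<theta> - \<phi>))\<close> is
  \<open>sin \<phi> * poly U (cos \<phi>)\<close>. Its derivative at 0 equals both
  \<open>poly U 1\<close> and the left-hand side; interpolating \<open>U\<close> at 1 gives the
  right-hand side.\<close>

lemma riesz_formula:
  fixes Q :: "real poly"
  assumes "degree Q \<le> n" "0 < n"
  shows "sin \<theta> * poly (pderiv Q) (cos \<theta>) =
    (\<Sum>j<n. riesz_weight n j / 2 *
       (poly Q (cos (\<theta> - cheb_angle n j)) - poly Q (cos (\<theta> + cheb_angle n j))))"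
proof -
  obtain E U where U: "degree U \<le> n - 1"
    and p: "\<And>\<phi>. poly Q (cos (\<theta> + \<phi>)) = poly E (cos \<phi>) - sin \<phi> * poly U (cos \<phi>)"
    and m: "\<And>\<phi>. poly Q (cos (\<theta> - \<phi>)) = poly E (cos \<phi>) + sin \<phi> * poly U (cos \<phi>)"
    using poly_cos_add_split[OF assms(1), of \<theta>] by blast
  have diff: "poly Q (cos (\<theta> - \<phi>)) - poly Q (cos (\<theta> + \<phi>)) = 2 * (sin \<phi> * poly U (cos \<phi>))" for \<phi>
    by (simp add: p m)
  have D: "((\<lambda>t. poly Q (cos (f t))) has_real_derivative
       - poly (pderiv Q) (cos (f t)) * (sin (f t) * f')) (at t)"
    if "(f has_real_derivative f') (at t)" for f :: "real \<Rightarrow> real" and f' t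
    using that by (auto intro!: derivative_eq_intros DERIV_chain2[OF poly_DERIV] simp: algebra_simps)
  have D1: "((\<lambda>\<phi>. poly Q (cos (\<theta> - \<phi>)) - poly Q (cos (\<theta> + \<phi>))) has_real_derivative
      2 * (sin \<theta> * poly (pderiv Q) (cos \<theta>))) (at 0)"
  proof -
    have a: "((\<lambda>\<phi>. \<theta> - \<phi>) has_real_derivative -1) (at 0)" "((\<lambda>\<phi>. \<theta> + \<phi>) has_real_derivative 1) (at 0)"
      by (auto intro!: derivative_eq_intros)
    show ?thesis using DERIV_diff[OF D[OF a(1)] D[OF a(2)]] by (simp add: algebra_simps)
  qed
  have D2: "((\<lambda>\<phi>. 2 * (sin \<phi> * poly U (cos \<phi>))) has_real_derivative 2 * poly U 1) (at 0)"
    by (auto intro!: derivative_eq_intros DERIV_chain2[OF poly_DERIV])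
  have "sin \<theta> * poly (pderiv Q) (cos \<theta>) = poly U 1"
    using DERIV_unique[OF D1[unfolded diff] D2] by simp
  also have "\<dots> = (\<Sum>j<n. riesz_weight n j * (sin (cheb_angle n j) * poly U (cos (cheb_angle n j))))"
    using U assms by (intro riesz_interpolation_at_1) auto
  also have "\<dots> = (\<Sum>j<n. riesz_weight n j / 2 *
       (poly Q (cos (\<theta> - cheb_angle n j)) - poly Q (cos (\<theta> + cheb_angle n j))))"
    by (simp add: diff)
  finally show ?thesis .
qed

lemma bernstein_inequality:
  fixes Q :: "real poly"
  assumes Q: "degree Q \<le> n" "0 < n" and M: "\<And>t. \<bar>t\<bar> \<le> 1 \<Longrightarrow> \<bar>poly Q t\<bar> \<le> M"
  shows "\<bar>sin \<theta> * poly (pderiv Q) (cos \<theta>)\<bar> \<le> real n * M"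
proof -
  have "\<bar>sin \<theta> * poly (pderiv Q) (cos \<theta>)\<bar> \<le> (\<Sum>j<n. \<bar>riesz_weight n j\<bar> * M)"
    unfolding riesz_formula[OF Q, of \<theta>]
  proof (intro order_trans[OF sum_abs] sum_mono)
    fix j
    have "\<bar>poly Q (cos (\<theta> - cheb_angle n j)) - poly Q (cos (\<theta> + cheb_angle n j))\<bar> \<le> 2 * M"
      using M[of "cos (\<theta> - cheb_angle n j)"] M[of "cos (\<theta> + cheb_angle n j)"] by (simp add: abs_le_iff)
    then have "\<bar>riesz_weight n j / 2\<bar> * \<bar>poly Q (cos (\<theta> - cheb_angle n j)) - poly Q (cos (\<theta> + cheb_angle n j))\<bar>
      \<le> \<bar>riesz_weight n j / 2\<bar> * (2 * M)" by (intro mult_left_mono) auto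
    then show "\<bar>riesz_weight n j / 2 * (poly Q (cos (\<theta> - cheb_angle n j)) - poly Q (cos (\<theta> + cheb_angle n j)))\<bar>
      \<le> \<bar>riesz_weight n j\<bar> * M" by (simp add: abs_mult)
  qed
  then show ?thesis using sum_abs_riesz_weight[OF Q(2)] by (simp flip: sum_distrib_right)
qed

text \<open>In absolute value the sine of \<open>n\<close> times an angle is at most
  \<open>n\<close> times its sine, and \<open>n\<close> times the first Chebyshev angle is a right
  angle.\<close>

lemma sin_cheb_angle_0_ge:
  assumes "0 < n"
  shows "1 / real n \<le> sin (cheb_angle n 0)"
proof -
  have le: "\<bar>sin (real m * \<phi>)\<bar> \<le> real m * \<bar>sin \<phi>\<bar>" for m and \<phi> :: real
  proof (induction m)
    case (Suc m)
    have "\<bar>sin (real (Suc m) * \<phi>)\<bar> = \<bar>sin (real m * \<phi>) * cos \<phi> + cos (real m * \<phi>) * sin \<phi>\<bar>"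
      by (simp add: distrib_right sin_add algebra_simps)
    also have "\<dots> \<le> \<bar>sin (real m * \<phi>)\<bar> * \<bar>cos \<phi>\<bar> + \<bar>cos (real m * \<phi>)\<bar> * \<bar>sin \<phi>\<bar>"
      by (metis abs_mult abs_triangle_ineq)
    also have "\<dots> \<le> \<bar>sin (real m * \<phi>)\<bar> * 1 + 1 * \<bar>sin \<phi>\<bar>"
      by (intro add_mono mult_mono) auto
    finally show ?case using Suc by (simp add: algebra_simps)
  qed simp
  have "real n * cheb_angle n 0 = pi / 2" using assms by (simp add: cheb_angle_def)
  then have "sin (real n * cheb_angle n 0) = 1" by (simp only: sin_pi_half)
  then have "1 \<le> real n * sin (cheb_angle n 0)"
    using le[of n "cheb_angle n 0"] sin_cheb_angle_pos[OF assms] by simp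
  then show ?thesis using assms by (simp add: field_simps)
qed

lemma markov_inequality:
  fixes Q :: "real poly"
  assumes Q: "degree Q \<le> n" "0 < n" and M: "\<And>t. \<bar>t\<bar> \<le> 1 \<Longrightarrow> \<bar>poly Q t\<bar> \<le> M"
    and x: "\<bar>x\<bar> \<le> 1"
  shows "\<bar>poly (pderiv Q) x\<bar> \<le> (real n)\<^sup>2 * M"
proof -
  have near: "\<bar>poly (pderiv P) t\<bar> \<le> (real n)\<^sup>2 * M"
    if P: "degree P \<le> n" "\<And>t. \<bar>t\<bar> \<le> 1 \<Longrightarrow> \<bar>poly P t\<bar> \<le> M" and t: "cos (cheb_angle n 0) \<le> t" "t \<le> 1"
    for P :: "real poly" and t
  proof -
    \<comment> \<open>Bernstein's inequality supplies the hypothesis of Schur's argument, with the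
      bound \<open>real n * M\<close> at the nodes.\<close>
    have "\<bar>poly (pderiv P) t\<bar> \<le> real n * (real n * M)"
      using P Q t by (intro schur_near_endpoint bernstein_inequality)
        (auto simp: degree_pderiv)
    then show ?thesis by (simp add: power2_eq_square)
  qed
  \<comment> \<open>Beyond the extreme nodes Schur's argument applies, on the left after a
    reflection. Between them the sine is at least \<open>1 / real n\<close>, so Bernstein's
    inequality loses at most a factor \<open>n\<close>.\<close>
  consider "cos (cheb_angle n 0) \<le> x" | "x \<le> - cos (cheb_angle n 0)"
    | "\<bar>x\<bar> < cos (cheb_angle n 0)" by linarith
  then show ?thesis
  proof cases
    case 1
    then show ?thesis using near[OF Q(1) M] x by auto
  next
    case 2
    have "\<bar>poly (pderiv (Q \<circ>\<^sub>p [:0, -1:])) (- x)\<bar> \<le> (real n)\<^sup>2 * M"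
    proof (rule near)
      show "degree (Q \<circ>\<^sub>p [:0, -1:]) \<le> n" using Q by (simp add: degree_pcompose)
      show "\<bar>poly (Q \<circ>\<^sub>p [:0, -1:]) t\<bar> \<le> M" if "\<bar>t\<bar> \<le> 1" for t
        using M[of "- t"] that by (simp add: poly_pcompose)
    qed (use 2 x in auto)
    then show ?thesis by (simp add: pderiv_pcompose poly_pcompose pderiv_pCons)
  next
    case 3
    define \<theta> where "\<theta> = arccos x"
    have cos: "cos \<theta> = x" using x by (simp add: \<theta>_def cos_arccos_abs)
    have sin: "0 \<le> sin \<theta>" using x by (simp add: \<theta>_def sin_arccos_abs abs_square_le_1)
    have "(cos \<theta>)\<^sup>2 \<le> (cos (cheb_angle n 0))\<^sup>2"
      using 3 cos by (simp add: abs_le_square_iff [symmetric])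
    then have "(sin (cheb_angle n 0))\<^sup>2 \<le> (sin \<theta>)\<^sup>2"
      using sin_cos_squared_add[of \<theta>] sin_cos_squared_add[of "cheb_angle n 0"] by linarith
    then have "sin (cheb_angle n 0) \<le> sin \<theta>" using sin by (rule power2_le_imp_le)
    then have "1 / real n \<le> sin \<theta>" using sin_cheb_angle_0_ge[OF Q(2)] by linarith
    then have "1 / real n * \<bar>poly (pderiv Q) x\<bar> \<le> sin \<theta> * \<bar>poly (pderiv Q) x\<bar>"
      by (intro mult_right_mono) auto
    also have "\<dots> = \<bar>sin \<theta> * poly (pderiv Q) (cos \<theta>)\<bar>" using sin cos by (simp add: abs_mult)
    also have "\<dots> \<le> real n * M" by (rule bernstein_inequality[OF Q M])
    finally show ?thesis using Q by (simp add: field_simps power2_eq_square)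
  qed
qed

section \<open>Exact formulas for the derivative at an endpoint\<close>

text \<open>Interpolating \<open>pderiv Q\<close> at 1 calls for
  \<open>sin \<theta> * poly (pderiv Q) (cos \<theta>)\<close> at the node angles, and Riesz's
  formula expands each of these. \<sigma> tells the two shifts of that formula apart.\<close>

lemma endpoint_derivative_formula:
  fixes Q :: "real poly"
  assumes Q: "degree Q \<le> n" "0 < n"
  shows "poly (pderiv Q) 1 = (\<Sum>(j, i, \<sigma>)\<in>{..<n} \<times> {..<n} \<times> {-1, 1}.
    - \<sigma> * riesz_weight n j * riesz_weight n i / 2 * poly Q (cos (cheb_angle n j + \<sigma> * cheb_angle n i)))"
proof -
  have "degree (pderiv Q) < n" using Q by (simp add: degree_pderiv)
  from riesz_interpolation_at_1[OF this]
  show ?thesis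
    by (simp add: riesz_formula[OF Q] sum.cartesian_product[symmetric] sum_distrib_left algebra_simps)
qed

text \<open>The sign \<open>\<tau>\<close> selects the side of 0 on which the nodes lie; the factor 2 comes from
  rescaling \<open>[-1, 1]\<close> to an interval of length 1.\<close>

lemma one_sided_derivative_formula:
  assumes n: "0 < n" and \<tau>: "\<tau> = 1 \<or> \<tau> = (-1::real)"
  obtains A :: "(nat \<times> nat \<times> real) set" and w t :: "nat \<times> nat \<times> real \<Rightarrow> real"
  where "finite A" "\<And>a. a \<in> A \<Longrightarrow> 0 \<le> t a \<and> t a \<le> 1" "(\<Sum>a\<in>A. \<bar>w a\<bar>) = 2 * (real n)\<^sup>2"
    "\<And>q. degree q \<le> n \<Longrightarrow> poly (pderiv q) 0 = (\<Sum>a\<in>A. w a * poly q (\<tau> * t a))"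
proof
  let ?A = "{..<n} \<times> {..<n} \<times> {-1, 1::real}"
  define y where "y = (\<lambda>(j, i, \<sigma>). cos (cheb_angle n j + \<sigma> * cheb_angle n i))"
  define c where "c = (\<lambda>(j, i, \<sigma>). - \<sigma> * riesz_weight n j * riesz_weight n i / 2)"
  show "finite ?A" by simp
  show "0 \<le> (1 - y a) / 2 \<and> (1 - y a) / 2 \<le> 1" for a
    by (cases a) (auto simp: y_def)
  have "(\<Sum>a\<in>?A. \<bar>c a\<bar>) = (\<Sum>j<n. \<Sum>i<n. \<bar>riesz_weight n j\<bar> * \<bar>riesz_weight n i\<bar>)"
    by (simp add: c_def sum.cartesian_product' case_prod_unfold abs_mult)
  also have "\<dots> = (real n)\<^sup>2"
    using sum_abs_riesz_weight[OF n] by (simp add: power2_eq_square flip: sum_product)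
  finally show "(\<Sum>a\<in>?A. \<bar>- 2 * \<tau> * c a\<bar>) = 2 * (real n)\<^sup>2"
    using \<tau> by (auto simp: abs_mult simp flip: sum_distrib_left)
  fix q :: "real poly" assume q: "degree q \<le> n"
  \<comment> \<open>The affine substitution sends 1 to 0 and -1 to \<tau>. Its slope
    \<open>- \<tau> / 2\<close> has the inverse \<open>- 2 * \<tau>\<close>, which is the factor in
    front of \<open>c\<close>.\<close>
  define Q where "Q = q \<circ>\<^sub>p [:\<tau> / 2, - \<tau> / 2:]"
  have "degree Q \<le> n" using q \<tau> by (auto simp: Q_def degree_pcompose)
  then have *: "poly (pderiv Q) 1 = (\<Sum>a\<in>?A. c a * poly Q (y a))"
    using endpoint_derivative_formula[of Q n] n by (simp add: c_def y_def case_prod_unfold)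
  have "poly (pderiv Q) 1 = - \<tau> / 2 * poly (pderiv q) 0"
    by (simp add: Q_def pderiv_pcompose poly_pcompose pderiv_pCons)
  then have "poly (pderiv q) 0 = - 2 * \<tau> * poly (pderiv Q) 1" using \<tau> by auto
  also have "\<dots> = (\<Sum>a\<in>?A. - 2 * \<tau> * c a * poly q (\<tau> * ((1 - y a) / 2)))"
    unfolding * sum_distrib_left
    by (intro sum.cong refl) (simp add: Q_def poly_pcompose algebra_simps diff_divide_distrib)
  finally show "poly (pderiv q) 0 = (\<Sum>a\<in>?A. - 2 * \<tau> * c a * poly q (\<tau> * ((1 - y a) / 2)))" .
qed

section \<open>Closure properties and slices of \<open>Q_space\<close>\<close>

lemma Q_space_monomial: "(\<And>i. \<alpha> i \<le> k) \<Longrightarrow> monomial_fun \<alpha> \<in> Q_space k"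
  unfolding Q_space_def
  by (intro CollectI exI[of _ "\<lambda>\<beta>. if \<beta> = \<alpha> then 1 else 0"] ext)
    (simp add: if_distrib[where f = "\<lambda>c. c * _"] finite_multi_index cong: if_cong)

lemma Q_space_cmult:
  assumes "v \<in> Q_space k"
  shows "(\<lambda>x. b * v x) \<in> Q_space k"
proof -
  obtain c where "v = (\<lambda>x. \<Sum>\<alpha>\<in>{\<alpha>. \<forall>i. \<alpha> i \<le> k}. c \<alpha> * monomial_fun \<alpha> x)"
    using assms unfolding Q_space_def by blast
  then show ?thesis unfolding Q_space_def
    by (intro CollectI exI[of _ "\<lambda>\<alpha>. b * c \<alpha>"]) (simp add: sum_distrib_left mult.assoc)
qed

lemma Q_space_sum:
  assumes "\<And>a. a \<in> A \<Longrightarrow> f a \<in> Q_space k"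
  shows "(\<lambda>x. \<Sum>a\<in>A. f a x) \<in> Q_space k"
proof -
  have "\<forall>a\<in>A. \<exists>c. f a = (\<lambda>x. \<Sum>\<alpha>\<in>{\<alpha>. \<forall>i. \<alpha> i \<le> k}. c \<alpha> * monomial_fun \<alpha> x)"
    using assms unfolding Q_space_def by blast
  from bchoice[OF this] obtain c
    where "\<forall>a\<in>A. f a = (\<lambda>x. \<Sum>\<alpha>\<in>{\<alpha>. \<forall>i. \<alpha> i \<le> k}. c a \<alpha> * monomial_fun \<alpha> x)" ..
  then have "(\<Sum>a\<in>A. f a x) = (\<Sum>\<alpha>\<in>{\<alpha>. \<forall>i. \<alpha> i \<le> k}. (\<Sum>a\<in>A. c a \<alpha>) * monomial_fun \<alpha> x)" for x
    by (subst sum_distrib_right, subst sum.swap) simp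
  then show ?thesis unfolding Q_space_def by (intro CollectI exI[of _ "\<lambda>\<alpha>. \<Sum>a\<in>A. c a \<alpha>"] ext)
qed

lemma monomial_fun_slice:
  "monomial_fun \<alpha> (x + t *\<^sub>R axis i 1) = (x $ i + t) ^ \<alpha> i * (\<Prod>j\<in>UNIV - {i}. x $ j ^ \<alpha> j)"
  unfolding monomial_fun_def
  by (subst prod.remove[of _ i]) (auto simp: axis_def intro!: prod.cong)

text \<open>For \<open>\<alpha> i = 0\<close> the truncated exponent does no harm, since the
  coefficient \<open>real (\<alpha> i)\<close> vanishes.\<close>

lemma DERIV_monomial_fun_slice:
  "((\<lambda>t. monomial_fun \<alpha> (x + t *\<^sub>R axis i 1)) has_real_derivative
     real (\<alpha> i) * monomial_fun (\<alpha>(i := \<alpha> i - 1)) x) (at 0)"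
proof -
  have "monomial_fun (\<alpha>(i := \<alpha> i - 1)) x = (x $ i) ^ (\<alpha> i - 1) * (\<Prod>j\<in>UNIV - {i}. x $ j ^ \<alpha> j)"
    unfolding monomial_fun_def by (subst prod.remove[of _ i]) (auto intro!: prod.cong)
  then show ?thesis
    unfolding monomial_fun_slice by (auto intro!: derivative_eq_intros)
qed

text \<open>Differentiation only lowers exponents, so the same \<open>k\<close> remains valid and
  estimates for one derivative can be iterated.\<close>

lemma Q_space_partial_deriv:
  fixes v :: "real ^ 'n \<Rightarrow> real"
  assumes "v \<in> Q_space k"
  shows "partial_deriv i v \<in> Q_space k"
proof -
  let ?I = "{\<alpha>. \<forall>i. \<alpha> i \<le> k}"
  obtain c where v: "v = (\<lambda>x. \<Sum>\<alpha>\<in>?I. c \<alpha> * monomial_fun \<alpha> x)"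
    using assms unfolding Q_space_def by blast
  have "((\<lambda>t. v (x + t *\<^sub>R axis i 1)) has_real_derivative
      (\<Sum>\<alpha>\<in>?I. c \<alpha> * (real (\<alpha> i) * monomial_fun (\<alpha>(i := \<alpha> i - 1)) x))) (at 0)" for x
    unfolding v by (intro DERIV_sum DERIV_cmult DERIV_monomial_fun_slice)
  then have "partial_deriv i v = (\<lambda>x. \<Sum>\<alpha>\<in>?I. c \<alpha> * (real (\<alpha> i) * monomial_fun (\<alpha>(i := \<alpha> i - 1)) x))"
    unfolding partial_deriv_def using DERIV_imp_deriv by blast
  also have "\<dots> \<in> Q_space k"
  proof (intro Q_space_sum Q_space_cmult)
    fix \<alpha> :: "'n \<Rightarrow> nat" assume "\<alpha> \<in> ?I"
    then have "\<alpha> j - m \<le> k" for j m by (simp add: le_diff_conv trans_le_add1)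
    with \<open>\<alpha> \<in> ?I\<close> show "monomial_fun (\<alpha>(i := \<alpha> i - 1)) \<in> Q_space k"
      by (intro Q_space_monomial) simp
  qed
  finally show ?thesis .
qed

lemma Q_space_foldr_partial_deriv: "v \<in> Q_space k \<Longrightarrow> foldr partial_deriv is v \<in> Q_space k"
  by (induction "is") (auto intro: Q_space_partial_deriv)

text \<open>Reduces partial derivatives to one variable. As \<open>Q_space\<close> bounds each
  exponent separately, the restriction to a line parallel to an axis has degree at most
  \<open>k\<close>.\<close>

lemma Q_space_slice:
  assumes "v \<in> Q_space k"
  obtains q :: "real poly" where "degree q \<le> k" "\<And>t. v (x + t *\<^sub>R axis i 1) = poly q t"
    "partial_deriv i v x = poly (pderiv q) 0"
proof -
  let ?I = "{\<alpha>. \<forall>i. \<alpha> i \<le> k}"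
  obtain c where v: "v = (\<lambda>x. \<Sum>\<alpha>\<in>?I. c \<alpha> * monomial_fun \<alpha> x)"
    using assms unfolding Q_space_def by blast
  define q where "q = (\<Sum>\<alpha>\<in>?I. smult (c \<alpha> * (\<Prod>j\<in>UNIV - {i}. x $ j ^ \<alpha> j)) ([:x $ i, 1:] ^ \<alpha> i))"
  have "degree q \<le> k"
    unfolding q_def
    by (rule degree_sum_le) (auto simp: finite_multi_index degree_power_eq intro: order_trans[OF degree_smult_le])
  moreover have q: "v (x + t *\<^sub>R axis i 1) = poly q t" for t
    unfolding v q_def poly_sum monomial_fun_slice by (intro sum.cong) (auto simp: poly_power)
  moreover have "partial_deriv i v x = poly (pderiv q) 0"
    unfolding partial_deriv_def q by (intro DERIV_imp_deriv poly_DERIV)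
  ultimately show ?thesis using that by blast
qed

lemma continuous_on_Q_space:
  assumes "v \<in> Q_space k"
  shows "continuous_on S v"
proof -
  obtain c where v: "v = (\<lambda>x. \<Sum>\<alpha>\<in>{\<alpha>. \<forall>i. \<alpha> i \<le> k}. c \<alpha> * monomial_fun \<alpha> x)"
    using assms unfolding Q_space_def by blast
  show ?thesis unfolding v monomial_fun_def
    by (intro continuous_on_sum continuous_on_mult continuous_on_const continuous_on_prod
        continuous_on_power continuous_on_component continuous_on_id)
qed

section \<open>Integral estimates for one partial derivative\<close>

lemma continuous_on_abs_powr:
  fixes f :: "'a::topological_space \<Rightarrow> real"
  assumes "continuous_on S f" "1 \<le> r"
  shows "continuous_on S (\<lambda>x. \<bar>f x\<bar> powr r)"
  using assms by (intro continuous_on_powr' continuous_on_rabs continuous_on_const) auto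

lemma integrable_abs_powr_Q_space:
  "v \<in> Q_space k \<Longrightarrow> 1 \<le> r \<Longrightarrow> (\<lambda>x. \<bar>v x\<bar> powr r) integrable_on cbox a b"
  by (intro integrable_continuous continuous_on_abs_powr continuous_on_Q_space)

lemma mem_ref_cube: "x \<in> ref_cube \<longleftrightarrow> (\<forall>i. \<bar>x $ i\<bar> \<le> 1)"
  by (auto simp: ref_cube_def mem_box_cart abs_le_iff)

text \<open>\<open>powr_convex\<close> omits the endpoint 0.\<close>

lemma convex_on_powr_nonneg:
  assumes "1 \<le> r"
  shows "convex_on {0..} (\<lambda>x::real. x powr r)"
proof (rule convex_onI)
  fix t x y :: real assume t: "0 < t" "t < 1" and xy: "x \<in> {0..}" "y \<in> {0..}"
  have *: "(s * z) powr r \<le> s * z powr r" if "0 < s" "s < 1" "0 \<le> z" for s z :: real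
    using that assms powr_le_one_le[of s r] by (simp add: powr_mult mult_right_mono)
  show "((1 - t) *\<^sub>R x + t *\<^sub>R y) powr r \<le> (1 - t) * x powr r + t * y powr r"
  proof (cases "x = 0 \<or> y = 0")
    case True
    then show ?thesis using *[of t y] *[of "1 - t" x] t xy assms by auto
  next
    case False
    then show ?thesis using convex_onD[OF powr_convex[OF assms], of t x y] t xy by simp
  qed
qed simp

text \<open>Jensen's inequality for the convex power with weights
  \<open>\<bar>w a\<bar> / W\<close>: taking out \<open>W\<close> costs \<open>W powr r\<close>, and
  the normalisation gives one factor back.\<close>

lemma abs_sum_powr_le:
  fixes w g :: "'a \<Rightarrow> real"
  assumes r: "1 \<le> r" and A: "finite A" and W: "(\<Sum>a\<in>A. \<bar>w a\<bar>) = W" "0 < W"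
  shows "\<bar>\<Sum>a\<in>A. w a * g a\<bar> powr r \<le> W powr (r - 1) * (\<Sum>a\<in>A. \<bar>w a\<bar> * \<bar>g a\<bar> powr r)"
proof -
  have A0: "A \<noteq> {}" using W by auto
  have "\<bar>\<Sum>a\<in>A. w a * g a\<bar> \<le> (\<Sum>a\<in>A. \<bar>w a\<bar> * \<bar>g a\<bar>)"
    by (rule order_trans[OF sum_abs]) (simp add: abs_mult)
  also have "\<dots> = W * (\<Sum>a\<in>A. (\<bar>w a\<bar> / W) *\<^sub>R \<bar>g a\<bar>)"
    using W by (simp add: sum_distrib_left)
  finally have "\<bar>\<Sum>a\<in>A. w a * g a\<bar> powr r \<le> (W * (\<Sum>a\<in>A. (\<bar>w a\<bar> / W) *\<^sub>R \<bar>g a\<bar>)) powr r"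
    using r by (intro powr_mono2) auto
  also have "\<dots> = W powr r * (\<Sum>a\<in>A. (\<bar>w a\<bar> / W) *\<^sub>R \<bar>g a\<bar>) powr r"
    using W by (simp add: powr_mult sum_nonneg)
  also have "\<dots> \<le> W powr r * (\<Sum>a\<in>A. \<bar>w a\<bar> / W * \<bar>g a\<bar> powr r)"
    using W A A0 r
    by (intro mult_left_mono convex_on_sum[OF _ _ convex_on_powr_nonneg])
      (auto simp flip: sum_divide_distrib)
  also have "\<dots> = W powr (r - 1) * (\<Sum>a\<in>A. \<bar>w a\<bar> * \<bar>g a\<bar> powr r)"
    using W by (simp add: powr_diff sum_distrib_left)
  finally show ?thesis .
qed

text \<open>In the application \<open>cbox a b\<close> is the half of the cube from which steps of
  length at most 1 along axis \<open>i\<close> with sign \<tau> stay inside the cube. Jensen's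
  inequality applies pointwise; for each translate the integral is then at most that over the whole
  cube.\<close>

lemma integral_partial_deriv_shifted_box:
  fixes v :: "real ^ 'n \<Rightarrow> real"
  assumes k: "0 < k" and r: "1 \<le> r" and v: "v \<in> Q_space k" and \<tau>: "\<tau> = 1 \<or> \<tau> = (-1::real)"
    and sub: "\<And>x t. x \<in> cbox a b \<Longrightarrow> 0 \<le> t \<Longrightarrow> t \<le> 1 \<Longrightarrow> x + (\<tau> * t) *\<^sub>R axis i 1 \<in> ref_cube"
  shows "integral (cbox a b) (\<lambda>x. \<bar>partial_deriv i v x\<bar> powr r)
    \<le> (2 * (real k)\<^sup>2) powr r * integral ref_cube (\<lambda>x. \<bar>v x\<bar> powr r)"
proof -
  define W where "W = 2 * (real k)\<^sup>2"
  have W: "0 < W" using k by (simp add: W_def)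
  obtain A and w t :: "nat \<times> nat \<times> real \<Rightarrow> real" where A: "finite A"
    and t: "\<And>a. a \<in> A \<Longrightarrow> 0 \<le> t a \<and> t a \<le> 1" and w: "(\<Sum>a\<in>A. \<bar>w a\<bar>) = W"
    and f: "\<And>q. degree q \<le> k \<Longrightarrow> poly (pderiv q) 0 = (\<Sum>a\<in>A. w a * poly q (\<tau> * t a))"
    unfolding W_def by (rule one_sided_derivative_formula[OF k \<tau>]) blast
  define h where "h s = (\<tau> * t s) *\<^sub>R (axis i 1 :: real ^ 'n)" for s
  let ?F = "\<lambda>x. \<bar>v x\<bar> powr r"
  have int: "(\<lambda>x. ?F (c + x)) integrable_on cbox a' b'" for c a' b'
    using integrable_abs_powr_Q_space[OF v r, of "a' + c" "b' + c"] integrable_on_shift_cbox[of ?F c a' b']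
    by (simp add: o_def)
  \<comment> \<open>Weights and nodes do not depend on \<open>x\<close>, so the derivative is one
    fixed combination of translates of \<open>v\<close>.\<close>
  have F: "partial_deriv i v x = (\<Sum>s\<in>A. w s * v (h s + x))" for x
  proof -
    obtain q where q: "degree q \<le> k" "\<And>t. v (x + t *\<^sub>R axis i 1) = poly q t"
      "partial_deriv i v x = poly (pderiv q) 0" using Q_space_slice[OF v] by blast
    show ?thesis unfolding q(3) f[OF q(1)] by (simp add: h_def add.commute[of _ x] q(2))
  qed
  have shift: "integral (cbox a b) (\<lambda>x. ?F (h s + x)) \<le> integral ref_cube ?F" if s: "s \<in> A" for s
  proof -
    have "integral (cbox a b) (\<lambda>x. ?F (h s + x)) = integral (cbox (a + h s) (b + h s)) ?F"
      using integral_shift_cbox_plus[of a b ?F "h s"] by (simp add: o_def)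
    also have "\<dots> \<le> integral ref_cube ?F"
    proof (rule integral_subset_le)
      have "cbox (a + h s) (b + h s) = (+) (h s) ` cbox a b"
        using cbox_translation[of "h s" a b] by (simp add: add.commute)
      then show "cbox (a + h s) (b + h s) \<subseteq> ref_cube"
        using sub t[OF s] by (auto simp: h_def add.commute)
      show "?F integrable_on cbox (a + h s) (b + h s)" "?F integrable_on ref_cube"
        unfolding ref_cube_def using int[of 0] by simp_all
    qed auto
    finally show ?thesis .
  qed
  have "integral (cbox a b) (\<lambda>x. \<bar>partial_deriv i v x\<bar> powr r)
    \<le> integral (cbox a b) (\<lambda>x. W powr (r - 1) * (\<Sum>s\<in>A. \<bar>w s\<bar> * ?F (h s + x)))"
  proof (rule integral_le)
    show "(\<lambda>x. \<bar>partial_deriv i v x\<bar> powr r) integrable_on cbox a b"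
      by (rule integrable_abs_powr_Q_space[OF Q_space_partial_deriv[OF v] r])
    show "(\<lambda>x. W powr (r - 1) * (\<Sum>s\<in>A. \<bar>w s\<bar> * ?F (h s + x))) integrable_on cbox a b"
      by (intro integrable_on_mult_right integrable_sum A int)
    show "\<bar>partial_deriv i v x\<bar> powr r \<le> W powr (r - 1) * (\<Sum>s\<in>A. \<bar>w s\<bar> * ?F (h s + x))" for x
      unfolding F by (rule abs_sum_powr_le[OF r A w W])
  qed
  also have "\<dots> = W powr (r - 1) * (\<Sum>s\<in>A. \<bar>w s\<bar> * integral (cbox a b) (\<lambda>x. ?F (h s + x)))"
    using A int by (simp add: integral_sum integrable_on_mult_right)
  also have "\<dots> \<le> W powr (r - 1) * (\<Sum>s\<in>A. \<bar>w s\<bar> * integral ref_cube ?F)"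
    by (intro mult_left_mono sum_mono shift) auto
  also have "\<dots> = W powr r * integral ref_cube ?F"
    using W w by (simp add: powr_diff flip: sum_distrib_right)
  finally show ?thesis unfolding W_def .
qed

text \<open>Where \<open>x $ i \<le> 0\<close> there is room for a step of length 1 upwards, where
  \<open>x $ i \<ge> 0\<close> downwards. Each half is compared with the whole cube, hence the
  factor 2.\<close>

lemma integral_partial_deriv_le:
  fixes v :: "real ^ 'n \<Rightarrow> real"
  assumes k: "0 < k" and r: "1 \<le> r" and v: "v \<in> Q_space k"
  shows "integral ref_cube (\<lambda>x. \<bar>partial_deriv i v x\<bar> powr r)
    \<le> 2 * ((2 * (real k)\<^sup>2) powr r * integral ref_cube (\<lambda>x. \<bar>v x\<bar> powr r))"
proof -
  let ?e = "axis i 1 :: real ^ 'n"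
  let ?G = "\<lambda>x. \<bar>partial_deriv i v x\<bar> powr r"
  let ?K = "(2 * (real k)\<^sup>2) powr r * integral ref_cube (\<lambda>x. \<bar>v x\<bar> powr r)"
  have e: "?e \<in> Basis" by (simp add: axis_in_Basis_iff)
  have xe: "x \<bullet> ?e = x $ i" for x by (simp add: inner_axis)
  obtain b where lo: "ref_cube \<inter> {x. x \<bullet> ?e \<le> 0} = cbox (\<chi> i. - 1) b"
    using interval_split(1)[OF e] unfolding ref_cube_def by blast
  obtain a where hi: "ref_cube \<inter> {x. x \<bullet> ?e \<ge> 0} = cbox a (\<chi> i. 1)"
    using interval_split(2)[OF e] unfolding ref_cube_def by blast
  have "?G integrable_on ref_cube" unfolding ref_cube_def
    by (rule integrable_abs_powr_Q_space[OF Q_space_partial_deriv[OF v] r])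
  then have "integral ref_cube ?G = integral (ref_cube \<inter> {x. x \<bullet> ?e \<le> 0}) ?G
      + integral (ref_cube \<inter> {x. x \<bullet> ?e \<ge> 0}) ?G"
    unfolding ref_cube_def by (rule integral_split[OF _ e])
  also have "\<dots> \<le> ?K + ?K"
  proof (rule add_mono)
    show "integral (ref_cube \<inter> {x. x \<bullet> ?e \<le> 0}) ?G \<le> ?K"
      unfolding lo
    proof (rule integral_partial_deriv_shifted_box[OF k r v, of 1])
      fix x :: "real ^ 'n" and t :: real
      assume "x \<in> cbox (\<chi> i. - 1) b" and t: "0 \<le> t" "t \<le> 1"
      then have x: "\<bar>x $ j\<bar> \<le> 1" "x $ i \<le> 0" for j
        by (auto simp flip: lo simp: mem_ref_cube xe)
      show "x + (1 * t) *\<^sub>R axis i 1 \<in> ref_cube"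
        unfolding mem_ref_cube
      proof
        fix j
        show "\<bar>(x + (1 * t) *\<^sub>R axis i 1) $ j\<bar> \<le> 1"
          using x(1)[of j] x(2) t by (cases "j = i") (auto simp: axis_def)
      qed
    qed simp
    show "integral (ref_cube \<inter> {x. x \<bullet> ?e \<ge> 0}) ?G \<le> ?K"
      unfolding hi
    proof (rule integral_partial_deriv_shifted_box[OF k r v, of "-1"])
      fix x :: "real ^ 'n" and t :: real
      assume "x \<in> cbox a (\<chi> i. 1)" and t: "0 \<le> t" "t \<le> 1"
      then have x: "\<bar>x $ j\<bar> \<le> 1" "0 \<le> x $ i" for j
        by (auto simp flip: hi simp: mem_ref_cube xe)
      show "x + (-1 * t) *\<^sub>R axis i 1 \<in> ref_cube"
        unfolding mem_ref_cube
      proof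
        fix j
        show "\<bar>(x + (-1 * t) *\<^sub>R axis i 1) $ j\<bar> \<le> 1"
          using x(1)[of j] x(2) t by (cases "j = i") (auto simp: axis_def)
      qed
    qed simp
  qed
  finally show ?thesis by linarith
qed

section \<open>Norms with finite exponent and the Markov constant\<close>

lemma Lp_norm_nonneg: "0 \<le> Lp_norm (ereal r) S f"
  by (simp add: Lp_norm_def)

text \<open>Passes from the Lebesgue integral in the norm to the gauge integral of the preceding
  estimates.\<close>

lemma Lp_norm_ref_cube:
  fixes f :: "real ^ 'n \<Rightarrow> real"
  assumes "1 \<le> r" "continuous_on ref_cube f"
  shows "Lp_norm (ereal r) ref_cube f = (integral ref_cube (\<lambda>x. \<bar>f x\<bar> powr r)) powr (1 / r)"
proof -
  have "integrable (lebesgue_on ref_cube) (\<lambda>x. \<bar>f x\<bar> powr r)"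
    using assms unfolding ref_cube_def
    by (intro continuous_imp_integrable continuous_on_abs_powr)
  then show ?thesis
    using assms by (simp add: Lp_norm_def lebesgue_integral_eq_integral one_ereal_def ref_cube_def)
qed

text \<open>With \<open>n = real k * r - r + 1\<close> the last factor of the constant is
  \<open>(1 + r / n) powr (n / r)\<close>. Bernoulli's inequality bounds
  \<open>(1 + r / n) powr n\<close> below by \<open>1 + r \<ge> 2\<close>, and the two middle
  factors have a product of at least 1.\<close>

lemma markov_const_ge:
  assumes k: "1 \<le> k" and r: "1 \<le> r"
  shows "2 * 2 powr (1 / r) \<le> markov_const (ereal r) k"
proof -
  define n where "n = real k * r - r + 1"
  have n: "1 \<le> n" using mult_right_mono[of 1 "real k" r] k r by (simp add: n_def)
  \<comment> \<open>This is the reciprocal of \<open>markov_factor r\<close>: a base up to 1 gives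
    at most 1, and for a larger base the exponent may be raised to 1.\<close>
  have "(r - 1) powr (1 - 1 / r) \<le> r" if "1 < r"
  proof (cases "r - 1 \<le> 1")
    case True
    then show ?thesis using that powr_le1[of "1 - 1 / r" "r - 1"] by simp
  next
    case False
    then have "(r - 1) powr (1 - 1 / r) \<le> (r - 1) powr 1"
      using that by (intro powr_mono) auto
    then show ?thesis using that by simp
  qed
  then have "1 \<le> markov_factor r * r"
    using r powr_minus_divide[of "r - 1" "1 - 1 / r"]
    by (cases "r = 1") (auto simp: markov_factor_def le_divide_eq)
  also have "\<dots> \<le> markov_factor r * (r + 1 / real k)"
    by (intro mult_left_mono) (auto simp: markov_factor_def)
  finally have 1: "1 \<le> markov_factor r * (r + 1 / real k)" .
  have e: "real k - 1 + 1 / r = n * (1 / r)" using r by (simp add: n_def field_simps)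
  have "2 \<le> (1 + r / n) powr n"
  proof -
    have "ln 2 \<le> ln (1 + r)" using r by simp
    also have "ln (1 + r) \<le> n * ln (1 + r / n)"
    proof -
      \<comment> \<open>Bernoulli's inequality as concavity of \<open>ln\<close>:
        \<open>1 + r / n\<close> is the mean of 1 and \<open>1 + r\<close> with weight
        \<open>1 / n\<close> on the latter.\<close>
      have "(1 - 1 / n) * ln 1 + 1 / n * ln (1 + r) \<le> ln ((1 - 1 / n) *\<^sub>R 1 + (1 / n) *\<^sub>R (1 + r))"
        using convex_onD[OF ln_concave[unfolded concave_on_def], of "1 / n" 1 "1 + r"] n r by simp
      also have "(1 - 1 / n) *\<^sub>R 1 + (1 / n) *\<^sub>R (1 + r) = 1 + r / n" using n by (simp add: field_simps)
      finally show ?thesis using n by (simp add: field_simps)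
    qed
    finally have "ln 2 \<le> ln ((1 + r / n) powr n)" using r n by (simp add: ln_powr)
    moreover have "0 < 1 + r / n" using r n by (simp add: add_pos_pos)
    ultimately show ?thesis using n by (subst (asm) ln_le_cancel_iff) auto
  qed
  then have "2 powr (1 / r) \<le> ((1 + r / n) powr n) powr (1 / r)"
    using r by (intro powr_mono2) auto
  then have "2 powr (1 / r) \<le> (1 + r / n) powr (real k - 1 + 1 / r)"
    by (simp only: e powr_powr)
  then have "2 * (1 * 2 powr (1 / r)) \<le> 2 * ((markov_factor r * (r + 1 / real k)) * (1 + r / n) powr (real k - 1 + 1 / r))"
    using 1 by (intro mult_left_mono mult_mono) auto
  then show ?thesis by (simp add: markov_const_def n_def mult.assoc)
qed

lemma Lp_norm_partial_deriv_le:
  fixes v :: "real ^ 'n \<Rightarrow> real"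
  assumes k: "1 \<le> k" and r: "1 \<le> r" and v: "v \<in> Q_space k"
  shows "Lp_norm (ereal r) ref_cube (partial_deriv i v)
    \<le> markov_const (ereal r) k * (real k)\<^sup>2 * Lp_norm (ereal r) ref_cube v"
proof -
  let ?I = "\<lambda>u. integral ref_cube (\<lambda>x. \<bar>u x\<bar> powr r)"
  have nn: "0 \<le> ?I u" if "u \<in> Q_space k" for u :: "real ^ 'n \<Rightarrow> real"
    unfolding ref_cube_def by (intro integral_nonneg integrable_abs_powr_Q_space[OF that r]) simp
  have L: "Lp_norm (ereal r) ref_cube u = ?I u powr (1 / r)" if "u \<in> Q_space k" for u :: "real ^ 'n \<Rightarrow> real"
    using Lp_norm_ref_cube[OF r continuous_on_Q_space[OF that]] .
  have "?I (partial_deriv i v) powr (1 / r) \<le> (2 * ((2 * (real k)\<^sup>2) powr r * ?I v)) powr (1 / r)"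
    using integral_partial_deriv_le[OF _ r v] k r nn[OF Q_space_partial_deriv[OF v]] by (intro powr_mono2) auto
  also have "\<dots> = 2 * 2 powr (1 / r) * (real k)\<^sup>2 * ?I v powr (1 / r)"
    using k r nn[OF v] by (simp add: powr_mult powr_powr)
  also have "\<dots> \<le> markov_const (ereal r) k * (real k)\<^sup>2 * ?I v powr (1 / r)"
    using markov_const_ge[OF k r] by (intro mult_right_mono) auto
  finally show ?thesis using L[OF v] L[OF Q_space_partial_deriv[OF v]] by simp
qed

section \<open>The supremum norm\<close>

lemma Lp_norm_infinity_le:
  assumes "continuous_on ref_cube f" "\<And>x. x \<in> ref_cube \<Longrightarrow> \<bar>f x\<bar> \<le> M" "0 \<le> M"
  shows "Lp_norm \<infinity> ref_cube f \<le> M"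
proof -
  have S: "ref_cube \<in> sets lebesgue" by (simp add: ref_cube_def)
  have "(\<lambda>x. ereal \<bar>f x\<bar>) \<in> borel_measurable (lebesgue_on ref_cube)"
    using continuous_imp_measurable_on_sets_lebesgue[OF assms(1) S] by measurable
  moreover have "AE x in lebesgue_on ref_cube. ereal \<bar>f x\<bar> \<le> ereal M"
    using assms(2) S by (intro AE_I2) (simp add: space_restrict_space)
  ultimately have "esssup (lebesgue_on ref_cube) (\<lambda>x. ereal \<bar>f x\<bar>) \<le> ereal M" by (rule esssup_I)
  \<comment> \<open>The bound alone does not exclude the value \<open>-\<infinity>\<close>, which
    \<open>real_of_ereal\<close> sends to 0; \<open>0 \<le> M\<close> covers this case.\<close>
  then show ?thesis
    using assms(3) by (cases "esssup (lebesgue_on ref_cube) (\<lambda>x. ereal \<bar>f x\<bar>)") (auto simp: Lp_norm_def)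
qed

text \<open>The points of the open cube where \<open>\<bar>f x\<bar>\<close> exceeds the essential
  supremum form a set that is negligible and, by continuity, open, hence empty. Continuity also
  extends the bound to the boundary.\<close>

lemma abs_le_Lp_norm_infinity:
  fixes f :: "real ^ 'n \<Rightarrow> real"
  assumes f: "continuous_on UNIV f" and x: "x \<in> ref_cube"
  shows "\<bar>f x\<bar> \<le> Lp_norm \<infinity> ref_cube f"
proof -
  have S: "ref_cube \<in> sets (lebesgue :: (real ^ 'n) measure)" by (simp add: ref_cube_def)
  let ?E = "esssup (lebesgue_on ref_cube) (\<lambda>x. ereal \<bar>f x\<bar>)"
  let ?B = "box (\<chi> i. - 1) (\<chi> i. 1) :: (real ^ 'n) set"
  have Bne: "?B \<noteq> {}" by (auto simp: interval_ne_empty_cart)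
  have BS: "?B \<subseteq> ref_cube" by (simp add: ref_cube_def box_subset_cbox)
  have cl: "closure ?B = ref_cube" unfolding ref_cube_def by (rule closure_box[OF Bne])
  define N where "N = {x \<in> ?B. ?E < ereal \<bar>f x\<bar>}"
  have "AE x in lebesgue_on ref_cube. ereal \<bar>f x\<bar> \<le> ?E" by (rule esssup_AE)
  then have "AE x in lebesgue. x \<in> ref_cube \<longrightarrow> ereal \<bar>f x\<bar> \<le> ?E"
    using S by (subst (asm) AE_restrict_space_iff) auto
  then obtain N' where "N' \<in> null_sets lebesgue" "{x. \<not> (x \<in> ref_cube \<longrightarrow> ereal \<bar>f x\<bar> \<le> ?E)} \<subseteq> N'"
    by (auto simp: eventually_ae_filter)
  then have "negligible N'" "N \<subseteq> N'"
    using BS by (auto simp: negligible_iff_null_sets N_def not_le)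
  then have "negligible N" by (rule negligible_subset)
  moreover have "open N"
  proof -
    have "continuous_on UNIV (\<lambda>x. ereal \<bar>f x\<bar>)"
      using f by (intro continuous_on_ereal continuous_intros)
    then have "open {x. ?E < ereal \<bar>f x\<bar>}"
      by (intro open_Collect_less continuous_on_const)
    moreover have "N = ?B \<inter> {x. ?E < ereal \<bar>f x\<bar>}" by (auto simp: N_def)
    ultimately show ?thesis by (simp add: open_Int open_box)
  qed
  ultimately have "N = {}" using open_not_negligible by blast
  then have B: "ereal \<bar>f y\<bar> \<le> ?E" if "y \<in> ?B" for y using that by (auto simp: N_def not_less)
  \<comment> \<open>\<open>?E\<close> has to be finite, since \<open>real_of_ereal\<close> maps both
    infinities to 0.\<close>
  obtain M where "0 \<le> M" "\<And>y. y \<in> ref_cube \<Longrightarrow> \<bar>f y\<bar> \<le> M"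
  proof -
    have "compact (f ` ref_cube)" unfolding ref_cube_def
      by (intro compact_continuous_image continuous_on_subset[OF f]) auto
    then have "bounded (f ` ref_cube)" by (rule compact_imp_bounded)
    then show ?thesis using that unfolding bounded_pos by (metis imageI less_imp_le real_norm_def)
  qed
  then have "?E \<le> ereal M"
    using S continuous_imp_measurable_on_sets_lebesgue[OF continuous_on_subset[OF f subset_UNIV] S]
    by (intro esssup_I AE_I2) (auto simp: space_restrict_space)
  moreover have "0 \<le> ?E" using B Bne by (metis abs_ge_zero all_not_in_conv ereal_less_eq(5) order_trans)
  ultimately obtain e where e: "?E = ereal e" by (cases ?E) auto
  have "\<bar>f x\<bar> \<le> e"
  proof (rule continuous_le_on_closure[of ?B "\<lambda>x. \<bar>f x\<bar>"])
    show "continuous_on (closure ?B) (\<lambda>x. \<bar>f x\<bar>)"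
      by (intro continuous_on_rabs continuous_on_subset[OF f subset_UNIV])
  qed (use B x e in \<open>auto simp: cl\<close>)
  then show ?thesis using e by (simp add: Lp_norm_def)
qed

lemma Lp_norm_infinity_partial_deriv_le:
  fixes v :: "real ^ 'n \<Rightarrow> real"
  assumes k: "1 \<le> k" and v: "v \<in> Q_space k"
  shows "Lp_norm \<infinity> ref_cube (partial_deriv i v) \<le> (real k)\<^sup>2 * Lp_norm \<infinity> ref_cube v"
proof (rule Lp_norm_infinity_le)
  let ?M = "Lp_norm \<infinity> ref_cube v"
  have M: "\<bar>v y\<bar> \<le> ?M" if "y \<in> ref_cube" for y
    using abs_le_Lp_norm_infinity[OF continuous_on_Q_space[OF v] that] .
  have "0 \<in> (ref_cube :: (real ^ 'n) set)" by (simp add: mem_ref_cube)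
  from M[OF this] show "0 \<le> (real k)\<^sup>2 * ?M" by simp
  fix x :: "real ^ 'n" assume x: "x \<in> ref_cube"
  obtain q where q: "degree q \<le> k" "\<And>t. v (x + t *\<^sub>R axis i 1) = poly q t"
    "partial_deriv i v x = poly (pderiv q) 0" using Q_space_slice[OF v] by blast
  \<comment> \<open>Recentring makes the \<open>i\<close>-th coordinate itself the parameter, so the
    slice of the cube is \<open>[-1, 1]\<close> and Markov's inequality applies at
    \<open>x $ i\<close>.\<close>
  define Q where "Q = q \<circ>\<^sub>p [:- (x $ i), 1:]"
  have "\<bar>poly (pderiv Q) (x $ i)\<bar> \<le> (real k)\<^sup>2 * ?M"
  proof (rule markov_inequality)
    show "degree Q \<le> k" using q by (simp add: Q_def degree_pcompose)
    show "\<bar>poly Q t\<bar> \<le> ?M" if "\<bar>t\<bar> \<le> 1" for t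
    proof -
      have "poly Q t = v (x + (t - x $ i) *\<^sub>R axis i 1)" by (simp add: Q_def poly_pcompose q)
      also have "\<bar>\<dots>\<bar> \<le> ?M" using x that by (intro M) (auto simp: mem_ref_cube axis_def)
      finally show ?thesis .
    qed
  qed (use k x in \<open>auto simp: mem_ref_cube\<close>)
  moreover have "poly (pderiv Q) (x $ i) = poly (pderiv q) 0"
    by (simp add: Q_def pderiv_pcompose poly_pcompose pderiv_pCons)
  ultimately show "\<bar>partial_deriv i v x\<bar> \<le> (real k)\<^sup>2 * ?M" using q by simp
qed (rule continuous_on_Q_space[OF Q_space_partial_deriv[OF v]])

section \<open>Multi-indices and iterated derivatives\<close>

text \<open>Stars and bars: enumerating the coordinates sends multi-indices injectively to lists of
  length \<open>CARD('n) + 1\<close> with sum \<open>l\<close>.\<close>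

lemma card_multi_index_le:
  "card {\<alpha> :: 'n::finite \<Rightarrow> nat. sum \<alpha> UNIV \<le> l} \<le> (CARD('n) + l) choose l"
proof -
  obtain xs :: "'n list" where xs: "set xs = UNIV" "distinct xs"
    using finite_distinct_list[of "UNIV :: 'n set"] by auto
  let ?B = "{ys :: nat list. length ys = Suc (CARD('n)) \<and> sum_list ys = l}"
  \<comment> \<open>the head of the list is a slack variable\<close>
  let ?f = "\<lambda>\<alpha>. (l - sum \<alpha> UNIV) # map \<alpha> xs"
  have B: "card ?B = (CARD('n) + l) choose l"
    by (simp add: card_length_sum_list add.commute)
  then have fin: "finite ?B" by (intro card_ge_0_finite) (simp add: zero_less_binomial)
  have inj: "inj_on ?f {\<alpha>. sum \<alpha> UNIV \<le> l}"
    using xs by (auto simp: inj_on_def map_eq_conv)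
  have sub: "?f ` {\<alpha>. sum \<alpha> UNIV \<le> l} \<subseteq> ?B"
    using xs by (auto simp: sum_list_distinct_conv_sum_set distinct_card[symmetric])
  show ?thesis using card_inj_on_le[OF inj sub fin] unfolding B .
qed

text \<open>Exposes the chosen list of directions by its length, through which it enters the
  estimates.\<close>

lemma multi_deriv_foldr:
  obtains "is" where "multi_deriv \<alpha> f = foldr partial_deriv is f" "length is = sum \<alpha> UNIV"
proof
  let ?is = "SOME is. \<forall>i. count_list is i = \<alpha> i"
  show "multi_deriv \<alpha> f = foldr partial_deriv ?is f" by (simp add: multi_deriv_def)
  have "\<forall>i. count_list ?is i = \<alpha> i" by (rule someI_ex[OF ex_direction_list])
  then have "sum \<alpha> UNIV = sum (count_list ?is) UNIV" by simp
  then show "length ?is = sum \<alpha> UNIV" by (simp add: sum_count_set)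
qed

text \<open>An abstract \<open>N\<close> lets one induction serve finite and infinite exponents;
  closure of \<open>Q_space\<close> under \<open>partial_deriv\<close> makes \<open>step\<close>
  applicable to every intermediate function.\<close>

lemma norm_foldr_partial_deriv_le:
  fixes v :: "real ^ 'n \<Rightarrow> real" and N :: "(real ^ 'n \<Rightarrow> real) \<Rightarrow> real"
  assumes step: "\<And>i u. u \<in> Q_space k \<Longrightarrow> N (partial_deriv i u) \<le> K * N u" and "0 \<le> K"
    and v: "v \<in> Q_space k"
  shows "N (foldr partial_deriv is v) \<le> K ^ length is * N v"
proof (induction "is")
  case (Cons i "is")
  have "N (partial_deriv i (foldr partial_deriv is v)) \<le> K * N (foldr partial_deriv is v)"
    by (rule step[OF Q_space_foldr_partial_deriv[OF v]])
  also have "\<dots> \<le> K * (K ^ length is * N v)"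
    using Cons \<open>0 \<le> K\<close> by (rule mult_left_mono)
  finally show ?case by (simp add: mult.assoc)
qed simp

lemma norm_multi_deriv_le:
  fixes v :: "real ^ 'n \<Rightarrow> real" and N :: "(real ^ 'n \<Rightarrow> real) \<Rightarrow> real"
  assumes step: "\<And>i u. u \<in> Q_space k \<Longrightarrow> N (partial_deriv i u) \<le> K * N u" and K: "1 \<le> K"
    and v: "v \<in> Q_space k" and "0 \<le> N v" and \<alpha>: "sum \<alpha> UNIV \<le> l"
  shows "N (multi_deriv \<alpha> v) \<le> K ^ l * N v"
proof -
  obtain "is" where "is": "multi_deriv \<alpha> v = foldr partial_deriv is v" "length is = sum \<alpha> UNIV"
    by (rule multi_deriv_foldr)
  have "N (multi_deriv \<alpha> v) \<le> K ^ length is * N v"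
    unfolding "is"(1) using K by (intro norm_foldr_partial_deriv_le[OF step _ v]) auto
  \<comment> \<open>\<open>1 \<le> K\<close> lets derivatives of order below \<open>l\<close> share
    the bound for order \<open>l\<close>.\<close>
  also have "\<dots> \<le> K ^ l * N v"
    using K \<alpha> "is"(2) \<open>0 \<le> N v\<close> by (intro mult_right_mono power_increasing) auto
  finally show ?thesis .
qed

lemma multi_deriv_zero [simp]: "multi_deriv (\<lambda>_. 0) f = f"
proof -
  obtain "is" where "multi_deriv (\<lambda>_. 0) f = foldr partial_deriv is f" "length is = sum (\<lambda>_. 0) (UNIV :: 'a set)"
    by (rule multi_deriv_foldr)
  then show ?thesis by simp
qed

lemma multi_index_sum_le_0: "{\<alpha> :: 'n::finite \<Rightarrow> nat. sum \<alpha> UNIV \<le> 0} = {\<lambda>_. 0}"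
  by auto

section \<open>The Sobolev norm estimate\<close>

theorem corollary4:
  fixes v :: "real ^ 'n \<Rightarrow> real" and p :: ereal and k l :: nat
  assumes "1 \<le> k" and "1 \<le> p" and "v \<in> Q_space k"
  shows "sobolev_norm l p ref_cube v
    \<le> real ((CARD('n) + l) choose l) powr real_of_ereal (1 / p)
        * (markov_const p k * (real k)\<^sup>2) ^ l
        * sobolev_norm 0 p ref_cube v"
proof -
  let ?I = "{\<alpha> :: 'n \<Rightarrow> nat. sum \<alpha> UNIV \<le> l}"
  let ?L = "Lp_norm p ref_cube"
  define K where "K = markov_const p k * (real k)\<^sup>2"
  have I: "finite ?I" "?I \<noteq> {}"
    using finite_multi_index_sum by (auto intro: exI[of _ "\<lambda>_. 0"])
  show ?thesis
  proof (cases "p = \<infinity>")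
    case True
    have K: "K = (real k)\<^sup>2" using True by (simp add: K_def markov_const_def)
    have "0 \<in> (ref_cube :: (real ^ 'n) set)" by (simp add: mem_ref_cube)
    from abs_le_Lp_norm_infinity[OF continuous_on_Q_space[OF assms(3)] this]
    have nn: "0 \<le> ?L v" using True by simp
    have "?L (multi_deriv \<alpha> v) \<le> K ^ l * ?L v" if "\<alpha> \<in> ?I" for \<alpha>
    proof (rule norm_multi_deriv_le[where k = k])
      show "?L (partial_deriv i u) \<le> K * ?L u" if "u \<in> Q_space k" for i u
        using Lp_norm_infinity_partial_deriv_le[OF assms(1) that] True K by simp
      show "1 \<le> K" using assms(1) K by (simp add: one_le_power)
    qed (use nn assms that in auto)
    then have "Max ((\<lambda>\<alpha>. ?L (multi_deriv \<alpha> v)) ` ?I) \<le> K ^ l * ?L v"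
      using I by (subst Max_le_iff) auto
    moreover have "sobolev_norm 0 p ref_cube v = ?L v"
      using True unfolding sobolev_norm_def multi_index_sum_le_0 by simp
    \<comment> \<open>The exponent is 0 here; the binomial coefficient is positive, so the power is
      1 in spite of \<open>0 powr 0 = 0\<close>.\<close>
    moreover have "real ((CARD('n) + l) choose l) powr real_of_ereal (1 / p) = 1"
      using True by simp
    ultimately show ?thesis
      using True unfolding K_def[symmetric] by (simp add: sobolev_norm_def)
  next
    case False
    then obtain r where p: "p = ereal r" and r: "1 \<le> r"
      using assms(2) by (cases p) auto
    have inv: "real_of_ereal (1 / p) = 1 / r" using p r by (simp add: one_ereal_def)
    have nn: "0 \<le> ?L u" for u using p Lp_norm_nonneg by simp
    have K: "1 \<le> K"
    proof -
      have "1 \<le> 2 powr (1 / r)" using r by (intro ge_one_powr_ge_zero) auto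
      then have "1 \<le> markov_const p k" using markov_const_ge[OF assms(1) r] p by simp
      moreover have "1 \<le> (real k)\<^sup>2" using assms(1) by (simp add: one_le_power)
      ultimately show ?thesis unfolding K_def using mult_mono[of 1 _ 1] by fastforce
    qed
    have D: "?L (multi_deriv \<alpha> v) \<le> K ^ l * ?L v" if "\<alpha> \<in> ?I" for \<alpha>
    proof (rule norm_multi_deriv_le[where k = k])
      show "?L (partial_deriv i u) \<le> K * ?L u" if "u \<in> Q_space k" for i u
        using Lp_norm_partial_deriv_le[OF assms(1) r that] p K_def by simp
    qed (use nn K assms that in auto)
    \<comment> \<open>All summands share one bound, so a bound on their number factors out; its root
      is the binomial factor of the claim.\<close>
    have "(\<Sum>\<alpha>\<in>?I. ?L (multi_deriv \<alpha> v) powr r) \<le> (\<Sum>\<alpha>\<in>?I. (K ^ l * ?L v) powr r)"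
      using r nn D by (intro sum_mono powr_mono2) auto
    also have "\<dots> \<le> real ((CARD('n) + l) choose l) * (K ^ l * ?L v) powr r"
      using card_multi_index_le[where 'n = 'n, of l] by (simp add: mult_right_mono)
    finally have "(\<Sum>\<alpha>\<in>?I. ?L (multi_deriv \<alpha> v) powr r) powr (1 / r)
      \<le> (real ((CARD('n) + l) choose l) * (K ^ l * ?L v) powr r) powr (1 / r)"
      using r by (intro powr_mono2) (auto intro: sum_nonneg)
    also have "\<dots> = real ((CARD('n) + l) choose l) powr (1 / r) * (K ^ l * ?L v)"
      using r nn[of v] K by (simp add: powr_mult powr_powr)
    finally have "sobolev_norm l p ref_cube v \<le> \<dots>"
      using False unfolding sobolev_norm_def inv by (simp add: p)
    moreover have "sobolev_norm 0 p ref_cube v = ?L v"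
      using False r nn[of v] unfolding sobolev_norm_def multi_index_sum_le_0 inv
      by (simp add: p powr_powr)
    ultimately show ?thesis
      unfolding K_def[symmetric] inv by (simp add: mult.assoc)
  qed
qed

end
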